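(* Let $n\in\mathbb{Z}$. For $t\neq 0$ and for all finite $z$, the generating functions of the generalized four parameter spherical Bessel and Bessel-Clifford functions are given by $$\sum_{n=-\infty}^\infty g_{n-\frac12}^{(b,c+\frac12)}(z;\rho)\,t^n=\sqrt{\frac{\pi}{2z}}\;{}_1F_1\Big((c;\rho),1;\big(t-\tfrac bt\big)\tfrac z2\Big),$$ $$\sum_{n=-\infty}^\infty C_n^{(b,\lambda)}(z;\rho)\,t^n={}_1F_1\Big((\lambda,\rho),1;t-\tfrac{bz}{t}\Big).$$
   Context: For $\operatorname{Re}(\rho)>0$ put $\Gamma_\rho(x)=\int_0^\infty t^{x-1}e^{-t-\rho/t}\,dt$. The generalized Pochhammer symbol is $(\lambda;\rho)_\nu:=\Gamma_\rho(\lambda+\nu)/\Gamma(\lambda)$ for $\operatorname{Re}(\rho)>0$, $\lambda,\nu\in\mathbb{C}$; it is also written $(\lambda,\rho)_\nu$. The extended confluent hypergeometric function is ${}_1F_1((a;\rho),d;x)={}_1F_1((a,\rho),d;x):=\sum_{n=0}^\infty \frac{(a;\rho)_n}{(d)_n}\frac{x^n}{n!}$, with $(d)_n=\Gamma(d+n)/\Gamma(d)$. The unified four parameter Bessel function is $$G_\nu^{(b,c)}(z;\rho):=\sum_{k=0}^\infty \frac{(-b)^k (c;\rho)_{2k+\nu}}{\Gamma(\nu+k+1)\,\Gamma(\nu+2k+1)}\,\frac{(z/2)^{2k+\nu}}{k!}$$ ($z,c,\nu\in\mathbb{C}$, $\operatorname{Re}(\nu)>-1$, $\operatorname{Re}(\rho)>0$).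 The generalized four parameter spherical Bessel function is $$g_\nu^{(b,c)}(z;\rho):=\sqrt{\tfrac{\pi}{2z}}\,G_{\nu+\frac12}^{(b,c-\frac12)}(z;\rho)=\frac{\sqrt\pi}{2}\sum_{k=0}^\infty\frac{(-b)^k(c-\frac12;\rho)_{2k+\nu+\frac12}}{k!\,\Gamma(\nu+k+\frac32)\,\Gamma(\nu+2k+\frac32)}\Big(\frac z2\Big)^{2k+\nu}$$ ($\operatorname{Re}(\nu)>-\frac32$, $\operatorname{Re}(c)>\frac12$, $\operatorname{Re}(\rho)>0$), and the generalized four parameter Bessel-Clifford function is $$C_\nu^{(b,\lambda)}(z;\rho):=z^{-\nu/2}G_\nu^{(b,\lambda)}(2\sqrt z;\rho)=\sum_{k=0}^\infty\frac{(-b)^k(\lambda;\rho)_{2k+\nu}}{k!\,\Gamma(\nu+k+1)\,\Gamma(\nu+2k+1)}\,(\sqrt z)^{2k}$$ ($\operatorname{Re}(\nu)>-1$, $\operatorname{Re}(\lambda)>0$, $\operatorname{Re}(\rho)>0$). At the negative orders occurring in the sums, the functions are given by the same formulas, with $1/\Gamma$ equal to $0$ at the poles of $\Gamma$. *)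

theory Defs
  imports "HOL-Analysis.Analysis"
begin

definition ext_Gamma :: "complex \<Rightarrow> complex \<Rightarrow> complex" where
  "ext_Gamma \<rho> x =
     (LINT t:{0<..}|lborel. of_real t powr (x - 1) * exp (- of_real t - \<rho> / of_real t))"

(* (lam; \<rho>)_\<nu> *)
definition ext_pochhammer :: "complex \<Rightarrow> complex \<Rightarrow> complex \<Rightarrow> complex" where
  "ext_pochhammer lam \<rho> \<nu> = ext_Gamma \<rho> (lam + \<nu>) / Gamma lam"

(* 1F1((a; \<rho>), d; x). By pochhammer_Gamma, pochhammer d n is Gamma (d + n) / Gamma d unless d is
   a nonpositive integer. *)
definition ext_1F1 :: "complex \<Rightarrow> complex \<Rightarrow> complex \<Rightarrow> complex \<Rightarrow> complex" where
  "ext_1F1 a \<rho> d x =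
     (\<Sum>n. ext_pochhammer a \<rho> (of_nat n) / pochhammer d n * x ^ n / fact n)"

(* Principal power with 0^0 = 1; the library has 0 powr 0 = 0, which would drop the constant term
   of the Bessel series of order 0 at the origin. *)
definition cpower :: "complex \<Rightarrow> complex \<Rightarrow> complex" where
  "cpower z a = (if a = 0 then 1 else z powr a)"

(* G_\<nu>^(b,c)(z; \<rho>). The factors 1 / Gamma are written with the entire function rGamma, which
   vanishes at the poles of Gamma; this covers negative integer orders \<nu>. *)
definition bessel_G ::
  "complex \<Rightarrow> complex \<Rightarrow> complex \<Rightarrow> complex \<Rightarrow> complex \<Rightarrow> complex" where
  "bessel_G \<nu> b c z \<rho> =
     (\<Sum>k. (- b) ^ k * ext_pochhammer c \<rho> (2 * of_nat k + \<nu>)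
            * rGamma (\<nu> + of_nat k + 1) * rGamma (\<nu> + 2 * of_nat k + 1)
            * cpower (z / 2) (2 * of_nat k + \<nu>) / fact k)"

(* g_\<nu>^(b,c)(z; \<rho>), with the principal square root. Distributing the square root over the series
   (lemma spherical_g_series) is compatible with principal branches off the negative real axis
   only: for negative real w, csqrt (1 / w) = - 1 / csqrt w. *)
definition spherical_g ::
  "complex \<Rightarrow> complex \<Rightarrow> complex \<Rightarrow> complex \<Rightarrow> complex \<Rightarrow> complex" where
  "spherical_g \<nu> b c z \<rho> =
     csqrt (of_real pi / (2 * z)) * bessel_G (\<nu> + 1 / 2) b (c - 1 / 2) z \<rho>"

(* C_\<nu>^(b,lam)(z; \<rho>). The series form also makes sense at z = 0; for z \<noteq> 0 it is
   z^(-\<nu>/2) G_\<nu>^(b,lam)(2 sqrt z; \<rho>), see bessel_clifford_eq_bessel_G. *)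
definition bessel_clifford ::
  "complex \<Rightarrow> complex \<Rightarrow> complex \<Rightarrow> complex \<Rightarrow> complex \<Rightarrow> complex" where
  "bessel_clifford \<nu> b lam z \<rho> =
     (\<Sum>k. (- b) ^ k * ext_pochhammer lam \<rho> (2 * of_nat k + \<nu>)
            * rGamma (\<nu> + of_nat k + 1) * rGamma (\<nu> + 2 * of_nat k + 1)
            * csqrt z ^ (2 * k) / fact k)"

lemma cpower_nonzero: "z \<noteq> 0 \<Longrightarrow> cpower z a = z powr a"
  by (simp add: cpower_def)

lemma bessel_clifford_eq_bessel_G:
  assumes z: "z \<noteq> 0"
    and summ: "summable (\<lambda>k. (- b) ^ k * ext_pochhammer lam \<rho> (2 * of_nat k + \<nu>)
            * rGamma (\<nu> + of_nat k + 1) * rGamma (\<nu> + 2 * of_nat k + 1)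
            * cpower (2 * csqrt z / 2) (2 * of_nat k + \<nu>) / fact k)"
  shows "bessel_clifford \<nu> b lam z \<rho> = z powr (- \<nu> / 2) * bessel_G \<nu> b lam (2 * csqrt z) \<rho>"
proof -
  have s: "csqrt z = exp (Ln z / 2)" using z by (rule csqrt_exp_Ln)
  have L: "Ln (csqrt z) = Ln z / 2"
    unfolding s using mpi_less_Im_Ln[OF z] Im_Ln_le_pi[OF z] pi_gt_zero
    by (intro Ln_exp) (simp_all del: pi_gt_zero)
  have *: "z powr (- \<nu> / 2) * cpower (2 * csqrt z / 2) (2 * of_nat k + \<nu>) = csqrt z ^ (2 * k)"
    for k
  proof -
    have "z powr (- \<nu> / 2) * cpower (2 * csqrt z / 2) (2 * of_nat k + \<nu>)
        = exp (- \<nu> / 2 * Ln z + (2 * of_nat k + \<nu>) * (Ln z / 2))"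
      unfolding exp_add using z by (simp add: cpower_nonzero powr_def L)
    also have "- \<nu> / 2 * Ln z + (2 * of_nat k + \<nu>) * (Ln z / 2) = of_nat (2 * k) * (Ln z / 2)"
      by (simp add: algebra_simps)
    finally show ?thesis unfolding s exp_of_nat_mult .
  qed
  show ?thesis
    unfolding bessel_clifford_def bessel_G_def suminf_mult[OF summ, symmetric] *[symmetric]
    by (simp add: mult_ac)
qed

lemma spherical_g_series:
  assumes z: "z \<notin> \<real>\<^sub>\<le>\<^sub>0"
    and summ: "summable (\<lambda>k. (- b) ^ k * ext_pochhammer (c - 1 / 2) \<rho> (2 * of_nat k + (\<nu> + 1 / 2))
            * rGamma (\<nu> + 1 / 2 + of_nat k + 1) * rGamma (\<nu> + 1 / 2 + 2 * of_nat k + 1)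
            * cpower (z / 2) (2 * of_nat k + (\<nu> + 1 / 2)) / fact k)"
  shows "spherical_g \<nu> b c z \<rho> =
     (\<Sum>k. of_real (sqrt pi) / 2 * ((- b) ^ k * ext_pochhammer (c - 1 / 2) \<rho> (2 * of_nat k + \<nu> + 1 / 2)
            * rGamma (\<nu> + of_nat k + 3 / 2) * rGamma (\<nu> + 2 * of_nat k + 3 / 2)
            * (z / 2) powr (2 * of_nat k + \<nu>) / fact k))"
proof -
  have z0: "z \<noteq> 0" using z by auto
  define w where "w = z / 2"
  have w: "w \<noteq> 0" "w \<notin> \<real>\<^sub>\<le>\<^sub>0"
    using z z0 by (auto simp: w_def complex_nonpos_Reals_iff)
  have "csqrt (of_real pi / (2 * z)) = csqrt (of_real (pi / 4) * inverse w)"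
    by (simp add: w_def field_simps)
  also have "\<dots> = of_real (sqrt (pi / 4)) * csqrt (inverse w)"
    using mpi_less_Arg[of "inverse w"] Arg_le_pi[of "inverse w"]
    by (subst csqrt_mult) (simp_all add: Arg_of_real csqrt_of_real del: of_real_divide)
  also have "sqrt (pi / 4) = sqrt pi / 2" by (simp add: real_sqrt_divide)
  also have "csqrt (inverse w) = exp (- Ln w / 2)"
    using w by (simp add: csqrt_exp_Ln Ln_inverse)
  finally have q: "csqrt (of_real pi / (2 * z)) = of_real (sqrt pi / 2) * exp (- Ln w / 2)" .
  have *: "csqrt (of_real pi / (2 * z)) * cpower (z / 2) (2 * of_nat k + (\<nu> + 1 / 2))
      = of_real (sqrt pi) / 2 * (z / 2) powr (2 * of_nat k + \<nu>)" for k
  proof -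
    have "exp (- Ln w / 2) * cpower w (2 * of_nat k + (\<nu> + 1 / 2)) = w powr (2 * of_nat k + \<nu>)"
      using w by (simp add: cpower_nonzero powr_def exp_add[symmetric] algebra_simps)
    then show ?thesis unfolding q w_def by simp
  qed
  have aux: "S * (A * q / F) = u * (A * p / F)" if "S * q = u * p" for S A q F u p :: complex
  proof -
    have "S * (A * q / F) = (S * q) * (A / F)" by simp
    also have "\<dots> = u * (A * p / F)" unfolding that by simp
    finally show ?thesis .
  qed
  have arith: "\<nu> + of_nat k + 3 / 2 = \<nu> + 1 / 2 + of_nat k + 1"
    "\<nu> + 2 * of_nat k + 3 / 2 = \<nu> + 1 / 2 + 2 * of_nat k + 1"
    "2 * of_nat k + \<nu> + 1 / 2 = 2 * of_nat k + (\<nu> + 1 / 2)" for k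
    by simp_all
  show ?thesis
    unfolding spherical_g_def bessel_G_def suminf_mult[OF summ, symmetric] arith
    by (intro suminf_cong aux *)
qed

end

theory Submission
  imports Defs
begin

text \<open>
  In a two-sided series over the order \<open>n\<close>, the power series index \<open>k\<close> of the Bessel
  function runs through the naturals. At integer order the reciprocal Gamma factors vanish unless
  \<open>p = n + k\<close> is a natural number, and then they combine with \<open>k!\<close> to
  \<open>(m choose k) / (m!)\<^sup>2\<close> with \<open>m = n + 2 k = p + k\<close> (lemma
  \<open>rGamma_product_at_integer_order\<close>). The remaining powers in the term, together with
  \<open>t\<^sup>n = t\<^sup>p / t\<^sup>k\<close>, split as \<open>u\<^sup>p v\<^sup>k\<close>. Collecting the terms with the same \<open>m\<close>
  therefore gives, by the binomial theorem, \<open>(c;\<rho>)\<^sub>m (u + v)\<^sup>m / (m!)\<^sup>2\<close>, which is the general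
  term of the confluent series with lower parameter 1. For the function \<open>G\<close> one has
  \<open>u = t z / 2\<close> and \<open>v = - b z / (2 t)\<close>; for the Bessel-Clifford function \<open>u = t\<close> and
  \<open>v = - b z / t\<close>. The spherical functions of order \<open>n - 1 / 2\<close> are a constant multiple of
  \<open>G\<close> at order \<open>n\<close>.

  Summing over \<open>n\<close> first or over \<open>m\<close> first is a rearrangement of one double series, and absolute
  convergence justifies it (lemmas \<open>has_sum_power_series_add_diagonals\<close> and
  \<open>has_sum_laurent_power_series_add\<close>). It follows from \<open>\<bar>\<Gamma>\<^sub>\<rho>(x)\<bar> \<le> \<Gamma>(Re x)\<close>: the coefficients
  \<open>(c;\<rho>)\<^sub>m / (m!)\<^sup>2\<close> are at most a constant times \<open>\<Gamma>(Re c + m) / (m!)\<^sup>2\<close>, so their power series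
  converges absolutely in the whole plane.
\<close>

section \<open>Growth of the coefficients\<close>

text \<open>
  For \<open>Re \<rho> \<ge> 0\<close> the factor \<open>exp (- \<rho> / t)\<close> has norm at most 1, so the integrand is dominated by
  that of Euler's integral for \<open>Gamma (Re x)\<close>.
\<close>
lemma norm_ext_Gamma_le:
  assumes "Re \<rho> \<ge> 0" and "Re x > 0"
  shows "norm (ext_Gamma \<rho> x) \<le> Gamma (Re x)"
proof -
  define h where "h = (\<lambda>t::real. indicator {0..} t * t powr (Re x - 1) / exp t)"
  have "has_bochner_integral lborel h (Gamma (Re x))"
    using Gamma_conv_nn_integral_real[OF assms(2)] Gamma_real_pos[OF assms(2)]
    unfolding h_def
    by (intro has_bochner_integral_nn_integral) (auto intro!: AE_I2)
  then have h: "integrable lborel h" "integral\<^sup>L lborel h = Gamma (Re x)"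
    by (auto simp: has_bochner_integral_iff)
  have "norm (indicator {0<..} t *\<^sub>R (of_real t powr (x - 1) * exp (- of_real t - \<rho> / of_real t))) \<le> h t"
    for t :: real
  proof (cases "t > 0")
    case True
    have "norm (exp (- of_real t - \<rho> / of_real t)) = exp (- t - Re \<rho> / t)"
      by (simp add: norm_exp_eq_Re)
    also have "\<dots> \<le> exp (- t)"
      using assms(1) True by simp
    finally show ?thesis
      using True by (simp add: h_def norm_mult norm_powr_real_powr exp_minus divide_inverse mult_left_mono)
  qed (auto simp: h_def)
  then have "norm (ext_Gamma \<rho> x) \<le> integral\<^sup>L lborel h"
    unfolding ext_Gamma_def set_lebesgue_integral_def
    by (intro order.trans[OF integral_norm_bound] integral_mono'[OF h(1)])
       (auto simp: h_def simp del: norm_scaleR)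
  then show ?thesis
    using h(2) by simp
qed

text \<open>
  One factorial is that of the term \<open>x\<^sup>m / m!\<close>, the other is the Pochhammer
  symbol of the lower parameter 1.
\<close>
definition hyp_coeff :: "complex \<Rightarrow> complex \<Rightarrow> nat \<Rightarrow> complex" where
  "hyp_coeff c \<rho> m = ext_pochhammer c \<rho> (of_nat m) / (fact m)\<^sup>2"

lemma ext_1F1_one: "ext_1F1 c \<rho> 1 x = (\<Sum>m. hyp_coeff c \<rho> m * x ^ m)"
  by (simp add: ext_1F1_def hyp_coeff_def pochhammer_fact[symmetric] power2_eq_square)

text \<open>
  The quotient of consecutive terms is \<open>(r + m) R / (m + 1)\<^sup>2\<close>, which tends to 0.
\<close>
lemma summable_Gamma_div_fact_squared:
  fixes r R :: real
  assumes "r > 0" and "R \<ge> 0"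
  shows "summable (\<lambda>m. Gamma (r + real m) / (fact m)\<^sup>2 * R ^ m)"
proof -
  define C where "C = 2 * (r + 1) * R"
  obtain N where N: "C \<le> real N"
    using real_arch_simple by blast
  define h where "h = (\<lambda>m. Gamma (r + real m) / (fact m)\<^sup>2 * R ^ m)"
  have "norm (h (Suc m)) \<le> 1 / 2 * norm (h m)" if "m \<ge> N" for m
  proof -
    have "Gamma (r + real m + 1) = (r + real m) * Gamma (r + real m)"
      using assms by (intro Gamma_plus1) (auto elim!: nonpos_Ints_cases)
    then have step: "h (Suc m) = (r + real m) * R / (real m + 1)\<^sup>2 * h m"
      by (simp add: h_def add_ac power_mult_distrib)
    (* r + m \<le> (r + 1) (m + 1) reduces the quotient to C / (2 (m + 1)), at most 1 / 2 for m \<ge> C. *)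
    have "(r + real m) * R \<le> (r + 1) * (real m + 1) * R"
      using assms by (intro mult_right_mono) (auto simp: algebra_simps)
    also have "\<dots> = C / 2 * (real m + 1)"
      by (simp add: C_def)
    also have "\<dots> \<le> ((real m + 1) / 2) * (real m + 1)"
      using N that by (intro mult_right_mono) simp_all
    finally have "(r + real m) * R / (real m + 1)\<^sup>2 \<le> 1 / 2"
      by (simp add: divide_le_eq power2_eq_square)
    moreover have "0 \<le> (r + real m) * R / (real m + 1)\<^sup>2"
      using assms by simp
    ultimately show ?thesis
      unfolding step norm_mult by (intro mult_right_mono) (simp_all only: real_norm_def abs_of_nonneg abs_ge_zero)
  qed
  then show ?thesis
    using summable_ratio_test[of "1 / 2" N h] by (simp add: h_def)
qed

lemma summable_hyp_coeff:
  fixes R :: real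
  assumes "Re \<rho> \<ge> 0" and "Re c > 0" and "R \<ge> 0"
  shows "summable (\<lambda>m. norm (hyp_coeff c \<rho> m) * R ^ m)"
proof (rule summable_comparison_test')
  show "summable (\<lambda>m. inverse (norm (Gamma c)) * (Gamma (Re c + real m) / (fact m)\<^sup>2 * R ^ m))"
    using assms by (intro summable_mult summable_Gamma_div_fact_squared)
  show "norm (norm (hyp_coeff c \<rho> m) * R ^ m)
      \<le> inverse (norm (Gamma c)) * (Gamma (Re c + real m) / (fact m)\<^sup>2 * R ^ m)" for m
  proof -
    have "norm (ext_Gamma \<rho> (c + of_nat m)) \<le> Gamma (Re c + real m)"
      using norm_ext_Gamma_le[of \<rho> "c + of_nat m"] assms by simp
    then have "norm (ext_Gamma \<rho> (c + of_nat m)) * (inverse (norm (Gamma c)) * (R ^ m / (fact m)\<^sup>2))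
        \<le> Gamma (Re c + real m) * (inverse (norm (Gamma c)) * (R ^ m / (fact m)\<^sup>2))"
      using assms by (intro mult_right_mono) auto
    then show ?thesis
      using assms
      by (simp add: hyp_coeff_def ext_pochhammer_def norm_mult norm_inverse norm_power
          divide_inverse mult_ac)
  qed
qed

section \<open>Laurent expansion of a power series in a sum\<close>

text \<open>
  The binomial theorem is used twice: on \<open>u + v\<close> to evaluate each finite row, and on
  \<open>norm u + norm v\<close> to see that the norms of the row's entries add up to the summand of the
  hypothesis. The latter makes the triangular family absolutely summable.
\<close>
lemma has_sum_power_series_add_diagonals:
  fixes a :: "nat \<Rightarrow> complex"
  assumes "summable (\<lambda>m. norm (a m) * (norm u + norm v) ^ m)"
  shows "((\<lambda>(m, k). a m * (of_nat (m choose k) * v ^ k * u ^ (m - k)))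
            has_sum (\<Sum>m. a m * (u + v) ^ m)) (Sigma UNIV (\<lambda>m. {..m}))"
proof -
  define f where "f = (\<lambda>(m, k). a m * (of_nat (m choose k) * v ^ k * u ^ (m - k)))"
  have norms: "(\<Sum>k\<le>m. norm (f (m, k))) = norm (a m) * (norm u + norm v) ^ m" for m
    unfolding add.commute[of "norm u"] binomial_ring sum_distrib_left f_def
    by (simp add: norm_mult norm_power)
  have rows: "(\<Sum>k\<le>m. f (m, k)) = a m * (u + v) ^ m" for m
    unfolding add.commute[of u] binomial_ring sum_distrib_left f_def by simp
  have "(\<lambda>p. norm (f p)) summable_on Sigma UNIV (\<lambda>m. {..m})"
    unfolding Infinite_Sum.abs_summable_on_Sigma_iff
    using norm_summable_imp_summable_on[of "\<lambda>m. norm (a m) * (norm u + norm v) ^ m"] assms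
    by (simp add: norms abs_mult)
  then have "f summable_on Sigma UNIV (\<lambda>m. {..m})"
    by (rule abs_summable_summable)
  then obtain S where S: "(f has_sum S) (Sigma UNIV (\<lambda>m. {..m}))"
    by (auto simp: summable_on_def)
  have "((\<lambda>m. a m * (u + v) ^ m) has_sum S) UNIV"
    using S by (rule has_sum_SigmaD) (simp flip: rows add: has_sum_finite)
  then have "S = (\<Sum>m. a m * (u + v) ^ m)"
    by (simp add: has_sum_imp_sums sums_unique)
  with S show ?thesis
    by (simp add: f_def)
qed

text \<open>
  The substitution \<open>n = m - 2 k\<close> maps the triangle \<open>k \<le> m\<close> bijectively onto the half plane
  \<open>0 \<le> n + k\<close>, outside of which the terms vanish. The product \<open>g n k * t powi n\<close> is prescribed rather
  than \<open>g n k\<close> itself because only this product is a multiple of a monomial in \<open>u\<close> and \<open>v\<close>.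
\<close>
lemma has_sum_laurent_power_series_add:
  fixes a :: "nat \<Rightarrow> complex" and g :: "int \<Rightarrow> nat \<Rightarrow> complex"
  assumes summ: "summable (\<lambda>m. norm (a m) * (norm u + norm v) ^ m)"
    and t: "t \<noteq> 0"
    and g: "\<And>n k. g n k * t powi n =
      (if 0 \<le> n + int k
       then a (nat (n + 2 * int k)) * (of_nat (nat (n + 2 * int k) choose k) * v ^ k * u ^ nat (n + int k))
       else 0)"
  shows "((\<lambda>n. (\<Sum>k. g n k) * t powi n) has_sum (\<Sum>m. a m * (u + v) ^ m)) UNIV"
proof -
  define F where "F = (\<lambda>(n, k). g n k * t powi n)"
  have "(F has_sum (\<Sum>m. a m * (u + v) ^ m)) {(n, k). 0 \<le> n + int k}"
    using has_sum_power_series_add_diagonals[OF summ]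
  proof (rule has_sum_reindex_bij_witness[THEN iffD1, rotated -1])
    show "(\<lambda>(n, k). (nat (n + 2 * int k), k)) ((\<lambda>(m, k). (int m - 2 * int k, k)) p) = p"
      if "p \<in> Sigma UNIV (\<lambda>m. {..m})" for p
      using that by auto
    show "F ((\<lambda>(m, k). (int m - 2 * int k, k)) p)
        = (case p of (m, k) \<Rightarrow> a m * (of_nat (m choose k) * v ^ k * u ^ (m - k)))"
      if "p \<in> Sigma UNIV (\<lambda>m. {..m})" for p
      using that by (auto simp: F_def g nat_diff_distrib)
  qed auto
  then have "(F has_sum (\<Sum>m. a m * (u + v) ^ m)) (UNIV \<times> UNIV)"
    by (rule has_sum_cong_neutral[THEN iffD1, rotated -1]) (auto simp: F_def g)
  moreover have "((\<lambda>k. F (n, k)) has_sum (\<Sum>k. g n k) * t powi n) UNIV" for n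
  proof -
    have "F summable_on UNIV \<times> UNIV"
      using calculation by (auto simp: summable_on_def)
    then have "(\<lambda>k. F (n, k)) summable_on UNIV"
      using summable_on_SigmaD1[of "\<lambda>n k. F (n, k)" UNIV "\<lambda>_. UNIV" n] by simp
    then obtain S where S: "((\<lambda>k. F (n, k)) has_sum S) UNIV"
      by (auto simp: summable_on_def)
    then have sums: "(\<lambda>k. t powi n * g n k) sums S"
      by (auto simp: F_def mult.commute dest: has_sum_imp_sums)
    (* The factor t powi n can be taken out of the series because it is nonzero. *)
    then have "summable (g n)"
      using t by (auto dest: sums_summable)
    then have "(\<Sum>k. g n k) * t powi n = S"
      using sums_unique[OF sums] by (simp add: suminf_mult mult.commute)
    with S show ?thesis by simp
  qed
  ultimately show ?thesis
    by (rule has_sum_SigmaD)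
qed

section \<open>Integer orders\<close>

text \<open>
  If \<open>n + k < 0\<close> then \<open>n + k + 1\<close> is a pole of the Gamma function. Otherwise \<open>n + 2 k\<close> is a natural
  number too, and the factors are \<open>1 / (n + k)!\<close>, \<open>1 / (n + 2 k)!\<close> and \<open>1 / k!\<close>.
\<close>
lemma rGamma_product_at_integer_order:
  "rGamma (of_int n + of_nat k + 1) * rGamma (of_int n + 2 * of_nat k + 1) / fact k
    = (if 0 \<le> n + int k
       then of_nat (nat (n + 2 * int k) choose k) / (fact (nat (n + 2 * int k)))\<^sup>2
       else (0::complex))"
proof (cases "0 \<le> n + int k")
  case True
  define p where "p = nat (n + int k)"
  have n: "n = int p - int k"
    using True by (simp add: p_def)
  have rG: "rGamma (of_nat j + 1) = inverse (fact j :: complex)" for j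
    by (metis Gamma_fact add.commute rGamma_inverse_Gamma)
  have "of_nat ((p + k) choose k) = (fact (p + k) / (fact k * fact p) :: complex)"
    by (simp add: binomial_fact)
  moreover have "of_int n + 2 * of_nat k + 1 = (of_nat (p + k) + 1 :: complex)"
    "of_int n + of_nat k + 1 = (of_nat p + 1 :: complex)" "nat (n + 2 * int k) = p + k"
    by (simp_all add: n)
  ultimately show ?thesis
    using True by (simp only: rG) (simp add: divide_simps power2_eq_square)
next
  case False
  then have "of_int n + of_nat k + 1 = (of_int (n + int k + 1) :: complex)" "n + int k + 1 \<le> 0"
    by auto
  then have "rGamma (of_int n + of_nat k + 1 :: complex) = 0"
    by (metis rGamma_eq_zero_iff nonpos_Ints_of_int)
  then show ?thesis
    using False by simp
qed

lemma cpower_of_nat: "cpower z (of_nat m) = z ^ m"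
  by (auto simp: cpower_def powr_nat')

text \<open>
  The common form of both generating functions. The series differ only in the factor \<open>w n k\<close>
  that carries the dependence on \<open>z\<close>; what matters is that it turns \<open>(- b)\<^sup>k t\<^sup>n\<close> into
  \<open>u\<^sup>p v\<^sup>k\<close> for \<open>n = p - k\<close>.
\<close>
lemma integer_order_generating_function:
  fixes w :: "int \<Rightarrow> nat \<Rightarrow> complex"
  assumes "Re \<rho> \<ge> 0" and "Re c > 0" and "t \<noteq> 0"
    and w: "\<And>p k. (- b) ^ k * w (int p - int k) k * t powi (int p - int k) = u ^ p * v ^ k"
  shows "((\<lambda>n. (\<Sum>k. (- b) ^ k * ext_pochhammer c \<rho> (2 * of_nat k + of_int n)
            * rGamma (of_int n + of_nat k + 1) * rGamma (of_int n + 2 * of_nat k + 1)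
            * w n k / fact k) * t powi n)
          has_sum ext_1F1 c \<rho> 1 (u + v)) UNIV"
  unfolding ext_1F1_one
proof (rule has_sum_laurent_power_series_add[OF _ \<open>t \<noteq> 0\<close>])
  show "summable (\<lambda>m. norm (hyp_coeff c \<rho> m) * (norm u + norm v) ^ m)"
    using assms by (intro summable_hyp_coeff) auto
  fix n :: int and k :: nat
  let ?m = "nat (n + 2 * int k)"
  have "(- b) ^ k * ext_pochhammer c \<rho> (2 * of_nat k + of_int n)
          * rGamma (of_int n + of_nat k + 1) * rGamma (of_int n + 2 * of_nat k + 1)
          * w n k / fact k * t powi n
     = ext_pochhammer c \<rho> (2 * of_nat k + of_int n) * ((- b) ^ k * w n k * t powi n)
          * (rGamma (of_int n + of_nat k + 1) * rGamma (of_int n + 2 * of_nat k + 1) / fact k)"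
    by simp
  also have "\<dots> = (if 0 \<le> n + int k
     then hyp_coeff c \<rho> ?m * (of_nat (?m choose k) * v ^ k * u ^ nat (n + int k)) else 0)"
  proof (cases "0 \<le> n + int k")
    case True
    define p where "p = nat (n + int k)"
    have n: "n = int p - int k"
      using True by (simp add: p_def)
    have m: "2 * of_nat k + of_int n = (of_nat ?m :: complex)"
      by (simp add: n)
    have power: "(- b) ^ k * w n k * t powi n = u ^ p * v ^ k"
      using w[of k p] by (simp only: n)
    show ?thesis
      unfolding rGamma_product_at_integer_order m power
      using True by (simp add: hyp_coeff_def p_def)
  qed (simp add: rGamma_product_at_integer_order)
  finally show "(- b) ^ k * ext_pochhammer c \<rho> (2 * of_nat k + of_int n)
          * rGamma (of_int n + of_nat k + 1) * rGamma (of_int n + 2 * of_nat k + 1)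
          * w n k / fact k * t powi n = \<dots>" .
qed

lemma bessel_G_generating_function:
  assumes "Re \<rho> \<ge> 0" and "Re c > 0" and "t \<noteq> 0"
  shows "((\<lambda>n. bessel_G (of_int n) b c z \<rho> * t powi n)
            has_sum ext_1F1 c \<rho> 1 ((t - b / t) * (z / 2))) UNIV"
proof -
  have "(t - b / t) * (z / 2) = t * (z / 2) + - b / t * (z / 2)"
    by (simp only: left_diff_distrib) simp
  moreover have "(- b) ^ k * cpower (z / 2) (2 * of_nat k + of_int (int p - int k))
      * t powi (int p - int k) = (t * (z / 2)) ^ p * (- b / t * (z / 2)) ^ k" for p k
  proof -
    have "2 * of_nat k + of_int (int p - int k) = (of_nat (p + k) :: complex)"
      by simp
    (* With B for - b and y for z / 2, simplification cannot move the sign or split the halves. *)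
    moreover have "B ^ k * y ^ (p + k) * t powi (int p - int k) = (t * y) ^ p * (B / t * y) ^ k" for B y
      using \<open>t \<noteq> 0\<close> by (simp add: power_int_diff power_add power_mult_distrib power_divide)
    ultimately show ?thesis
      by (simp only: cpower_of_nat)
  qed
  ultimately show ?thesis
    unfolding bessel_G_def using assms
    by (simp only:) (intro integer_order_generating_function)
qed

lemma bessel_clifford_generating_function:
  assumes "Re \<rho> \<ge> 0" and "Re c > 0" and "t \<noteq> 0"
  shows "((\<lambda>n. bessel_clifford (of_int n) b c z \<rho> * t powi n)
            has_sum ext_1F1 c \<rho> 1 (t - b * z / t)) UNIV"
proof -
  have "t - b * z / t = t + - b / t * z"
    by simp
  moreover have "(- b) ^ k * csqrt z ^ (2 * k) * t powi (int p - int k)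
      = t ^ p * (- b / t * z) ^ k" for p k
  proof -
    (* As above, B keeps simplification from moving the sign of - b. *)
    have "B ^ k * z ^ k * t powi (int p - int k) = t ^ p * (B / t * z) ^ k" for B
      using \<open>t \<noteq> 0\<close> by (simp add: power_int_diff power_mult_distrib power_divide)
    then show ?thesis
      by (simp only: power_mult power2_csqrt)
  qed
  ultimately show ?thesis
    unfolding bessel_clifford_def using assms
    by (simp only:) (intro integer_order_generating_function)
qed

theorem theorem6p2:
  fixes b c lam \<rho> t z :: complex
  assumes "Re \<rho> > 0" and "Re c > 0" and "Re lam > 0" and "t \<noteq> 0"
  shows "((\<lambda>n::int. spherical_g (of_int n - 1 / 2) b (c + 1 / 2) z \<rho> * t powi n)
            has_sum (csqrt (of_real pi / (2 * z)) * ext_1F1 c \<rho> 1 ((t - b / t) * (z / 2)))) UNIV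
       \<and> ((\<lambda>n::int. bessel_clifford (of_int n) b lam z \<rho> * t powi n)
            has_sum (ext_1F1 lam \<rho> 1 (t - b * z / t))) UNIV"
proof
  have g: "spherical_g (of_int n - 1 / 2) b (c + 1 / 2) z \<rho> * t powi n
      = csqrt (of_real pi / (2 * z)) * (bessel_G (of_int n) b c z \<rho> * t powi n)" for n
    by (simp add: spherical_g_def)
  show "((\<lambda>n::int. spherical_g (of_int n - 1 / 2) b (c + 1 / 2) z \<rho> * t powi n)
      has_sum (csqrt (of_real pi / (2 * z)) * ext_1F1 c \<rho> 1 ((t - b / t) * (z / 2)))) UNIV"
    unfolding g using assms by (intro has_sum_cmult_right bessel_G_generating_function) auto
  show "((\<lambda>n::int. bessel_clifford (of_int n) b lam z \<rho> * t powi n)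
      has_sum (ext_1F1 lam \<rho> 1 (t - b * z / t))) UNIV"
    using assms by (intro bessel_clifford_generating_function) auto
qed

end
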